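(* Let $\{G_n\}_{n\geq 1}$ be a sequence of real-valued random variables satisfying the ASCLT, and let $\{R_n\}_{n\geq 1}$ be a sequence of positive random variables (defined on the same probability space, not necessarily independent of $\{G_n\}$) converging almost surely to $1$. Then $\{G_n/R_n\}_{n\geq 1}$ satisfies the ASCLT. In other words, almost surely, for all $z\in\mathbb{R}$, $$\frac{1}{\log n}\sum_{k=1}^{n}\frac{1}{k}\mathbf{1}_{\{G_k\leq zR_k\}}\xrightarrow[n\to\infty]{}\phi(z).$$
   Context: $\phi(z):=P(N\leq z)$, where $N$ is a standard normal $\mathcal{N}(0,1)$ random variable, and $\mathbf{1}_A$ is the indicator of $A$. A sequence $\{Y_n\}_{n\geq 1}$ of real-valued random variables satisfies the ASCLT (almost sure central limit theorem) if, almost surely, for all $z\in\mathbb{R}$, $\frac{1}{\log n}\sum_{k=1}^{n}\frac{1}{k}\mathbf{1}_{\{Y_k\leq z\}}\to\phi(z)$ as $n\to\infty$. *)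

theory Defs
  imports "HOL-Probability.Probability"
begin

definition std_normal_cdf :: "real \<Rightarrow> real" where
  "std_normal_cdf = cdf std_normal_distribution"

(* Sequences indexed by n >= 1 are functions on nat whose value at 0 is unconstrained.
   The null set in the definition of the ASCLT does not depend on z. *)
definition (in prob_space) satisfies_ASCLT :: "(nat \<Rightarrow> 'a \<Rightarrow> real) \<Rightarrow> bool" where
  "satisfies_ASCLT Y \<longleftrightarrow>
     (\<forall>n\<ge>1. random_variable borel (Y n)) \<and>
     (AE \<omega> in M. \<forall>z::real.
        (\<lambda>n. 1 / ln (real n) * (\<Sum>k=1..n. 1 / real k * indicat_real {x. Y k x \<le> z} \<omega>))
          \<longlonglongrightarrow> std_normal_cdf z)"

end

theory Submission
  imports Defs
begin

text \<open>
  The argument is pathwise. Fix a sample point at which the logarithmic averages of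
  \<open>G\<close> converge for every threshold and \<open>R k\<close> tends to 1. The moving threshold
  \<open>z * R k\<close> then tends to \<open>z\<close>, so for each \<open>\<epsilon> > 0\<close> it lies in
  \<open>{z - \<epsilon>..z + \<epsilon>}\<close> for all but finitely many \<open>k\<close>. Since \<open>ln n\<close> diverges,
  finitely many terms do not affect a logarithmic average in the limit
  (\<open>log_average_le_asymptotically\<close>), so the averages for the moving threshold are
  asymptotically squeezed between those for the fixed thresholds \<open>z - \<epsilon>\<close> and
  \<open>z + \<epsilon>\<close>. Because the normal distribution has no atoms, its distribution function
  is continuous, and letting \<open>\<epsilon>\<close> tend to 0 gives the limit at \<open>z\<close>
  (\<open>log_average_moving_threshold\<close>). Almost sure positivity of every \<open>R k\<close> is what
  identifies the events \<open>G k / R k \<le> z\<close> and \<open>G k \<le> z * R k\<close>.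

  The exceptional null set is independent of \<open>z\<close> because the pathwise argument
  handles all \<open>z\<close> at the same sample point.
\<close>

definition log_average :: "(nat \<Rightarrow> real) \<Rightarrow> nat \<Rightarrow> real" where
  "log_average a n = 1 / ln (real n) * (\<Sum>k=1..n. 1 / real k * a k)"

text \<open>
  The finitely many indices at which the comparison may fail contribute at most a
  constant to the weighted sum, hence at most a constant multiple of \<open>1 / ln n\<close> to
  the average.
\<close>

lemma log_average_le_asymptotically:
  fixes a b :: "nat \<Rightarrow> real"
  assumes le: "eventually (\<lambda>k. a k \<le> b k) sequentially" and "0 < \<epsilon>"
  shows "eventually (\<lambda>n. log_average a n \<le> log_average b n + \<epsilon>) sequentially"
proof -
  obtain N where N: "\<And>k. k \<ge> N \<Longrightarrow> a k \<le> b k"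
    using le unfolding eventually_sequentially by blast
  define C where "C = (\<Sum>k=1..N. 1 / real k * \<bar>a k - b k\<bar>)"
  have bound: "(\<Sum>k=1..n. 1 / real k * a k) \<le> (\<Sum>k=1..n. 1 / real k * b k) + C" for n
  proof -
    have "(\<Sum>k=1..n. 1 / real k * a k) - (\<Sum>k=1..n. 1 / real k * b k)
        = (\<Sum>k=1..n. 1 / real k * (a k - b k))"
      by (simp only: right_diff_distrib sum_subtractf)
    also have "\<dots> \<le> (\<Sum>k=1..n. if k \<in> {1..N} then 1 / real k * \<bar>a k - b k\<bar> else 0)"
    proof (rule sum_mono)
      fix k assume "k \<in> {1..n}"
      show "1 / real k * (a k - b k)
          \<le> (if k \<in> {1..N} then 1 / real k * \<bar>a k - b k\<bar> else 0)"
      proof (cases "k \<in> {1..N}")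
        case True
        then show ?thesis by (auto intro!: divide_right_mono)
      next
        case False
        with \<open>k \<in> {1..n}\<close> have "a k - b k \<le> 0" using N[of k] by auto
        then have "1 / real k * (a k - b k) \<le> 0" by (simp add: divide_nonpos_nonneg)
        with False show ?thesis by (simp only: if_False)
      qed
    qed
    also have "\<dots> = (\<Sum>k\<in>{1..n} \<inter> {1..N}. 1 / real k * \<bar>a k - b k\<bar>)"
      by (rule sum.inter_restrict[symmetric]) simp
    also have "\<dots> \<le> C"
      unfolding C_def by (rule sum_mono2) auto
    finally show ?thesis by simp
  qed
  have "(\<lambda>n. C / ln (real n)) \<longlonglongrightarrow> 0"
    by (intro tendsto_divide_0[OF tendsto_const] filterlim_at_top_imp_at_infinity
        filterlim_compose[OF ln_at_top filterlim_real_sequentially])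
  then have "eventually (\<lambda>n. C / ln (real n) < \<epsilon>) sequentially"
    using \<open>0 < \<epsilon>\<close> by (rule order_tendstoD)
  then show ?thesis
  proof (rule eventually_mono[OF eventually_conj[OF _ eventually_ge_at_top[of 1]]])
    fix n :: nat
    assume n: "C / ln (real n) < \<epsilon> \<and> 1 \<le> n"
    have "log_average a n
        \<le> 1 / ln (real n) * ((\<Sum>k=1..n. 1 / real k * b k) + C)"
      unfolding log_average_def using n by (intro mult_left_mono bound) auto
    also have "\<dots> = log_average b n + C / ln (real n)"
      by (simp add: log_average_def add_divide_distrib)
    finally show "log_average a n \<le> log_average b n + \<epsilon>" using n by linarith
  qed
qed

text \<open>
  The indicators are monotone in the threshold, so fixed thresholds slightly below and
  slightly above \<open>z\<close> bracket the moving one from some index on. Continuity of \<open>F\<close> at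
  \<open>z\<close> makes the two limits close to each other.
\<close>

lemma log_average_moving_threshold:
  fixes g t :: "nat \<Rightarrow> real" and F :: "real \<Rightarrow> real"
  assumes lim: "\<And>x. log_average (\<lambda>k. of_bool (g k \<le> x)) \<longlonglongrightarrow> F x"
    and cont: "isCont F z"
    and t: "t \<longlonglongrightarrow> z"
  shows "log_average (\<lambda>k. of_bool (g k \<le> t k)) \<longlonglongrightarrow> F z"
proof (rule LIMSEQ_I)
  fix e :: real assume "0 < e"
  \<comment> \<open>One third of \<open>e\<close> each for the continuity of \<open>F\<close>, for the convergence at the
    fixed thresholds, and for the finitely many exceptional indices.\<close>
  obtain d where "d > 0" and d: "\<And>x. \<bar>x - z\<bar> < d \<Longrightarrow> \<bar>F x - F z\<bar> < e / 3"
    using cont[unfolded continuous_at_eps_delta dist_real_def, rule_format, of "e / 3"] \<open>0 < e\<close>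
    by auto
  define \<epsilon> where "\<epsilon> = d / 2"
  have "\<epsilon> > 0" using \<open>d > 0\<close> by (simp add: \<epsilon>_def)
  have F: "\<bar>F (z - \<epsilon>) - F z\<bar> < e / 3" "\<bar>F (z + \<epsilon>) - F z\<bar> < e / 3"
    using \<open>d > 0\<close> d[of "z - \<epsilon>"] d[of "z + \<epsilon>"] by (simp_all add: \<epsilon>_def)
  have near: "eventually (\<lambda>n. \<bar>log_average (\<lambda>k. of_bool (g k \<le> x)) n - F x\<bar> < e / 3) sequentially"
    for x
    using tendstoD[OF lim, of "e / 3" x] \<open>0 < e\<close> by (simp add: dist_real_def)
  have low: "eventually (\<lambda>k. z - \<epsilon> < t k) sequentially"
    using t \<open>\<epsilon> > 0\<close> by (intro order_tendstoD) auto
  have up: "eventually (\<lambda>k. t k < z + \<epsilon>) sequentially"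
    using t \<open>\<epsilon> > 0\<close> by (intro order_tendstoD) auto
  have "eventually (\<lambda>n. log_average (\<lambda>k. of_bool (g k \<le> z - \<epsilon>)) n
      \<le> log_average (\<lambda>k. of_bool (g k \<le> t k)) n + e / 3) sequentially"
    using \<open>0 < e\<close>
    by (intro log_average_le_asymptotically eventually_mono[OF low]) auto
  moreover have "eventually (\<lambda>n. log_average (\<lambda>k. of_bool (g k \<le> t k)) n
      \<le> log_average (\<lambda>k. of_bool (g k \<le> z + \<epsilon>)) n + e / 3) sequentially"
    using \<open>0 < e\<close>
    by (intro log_average_le_asymptotically eventually_mono[OF up]) auto
  ultimately have "eventually (\<lambda>n. norm (log_average (\<lambda>k. of_bool (g k \<le> t k)) n - F z) < e)
      sequentially"
    using near[of "z - \<epsilon>"] near[of "z + \<epsilon>"]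
  proof eventually_elim
    case (elim n)
    then show ?case using F unfolding real_norm_def by linarith
  qed
  then show "\<exists>no. \<forall>n\<ge>no. norm (log_average (\<lambda>k. of_bool (g k \<le> t k)) n - F z) < e"
    unfolding eventually_sequentially .
qed

lemma isCont_std_normal_cdf: "isCont std_normal_cdf z"
proof -
  interpret real_distribution std_normal_distribution
    by (rule real_dist_normal_dist)
  have "AE x in lborel. ennreal (std_normal_density x) * indicator {z} x = 0"
    using AE_lborel_singleton[of z] by eventually_elim simp
  then have "emeasure std_normal_distribution {z} = 0"
    by (simp add: emeasure_density nn_integral_0_iff_AE)
  then have "measure std_normal_distribution {z} = 0"
    by (simp add: measure_def)
  then show ?thesis
    unfolding std_normal_cdf_def isCont_cdf .
qed

theorem theorem2:
  fixes M :: "'a measure" and G R :: "nat \<Rightarrow> 'a \<Rightarrow> real"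
  assumes "prob_space M"
    and "prob_space.satisfies_ASCLT M G"
    and "\<And>n. n \<ge> 1 \<Longrightarrow> R n \<in> borel_measurable M"
    and "\<And>n. n \<ge> 1 \<Longrightarrow> AE \<omega> in M. 0 < R n \<omega>"
    and "AE \<omega> in M. (\<lambda>n. R n \<omega>) \<longlonglongrightarrow> 1"
  shows "prob_space.satisfies_ASCLT M (\<lambda>n \<omega>. G n \<omega> / R n \<omega>) \<and>
    (AE \<omega> in M. \<forall>z::real.
       (\<lambda>n. 1 / ln (real n) * (\<Sum>k=1..n. 1 / real k * indicat_real {x. G k x \<le> z * R k x} \<omega>))
         \<longlonglongrightarrow> std_normal_cdf z)"
proof -
  interpret prob_space M by fact
  have average_eq: "(\<lambda>n. 1 / ln (real n) * (\<Sum>k=1..n. 1 / real k * indicat_real {x. P k x} \<omega>))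
      = log_average (\<lambda>k. of_bool (P k \<omega>))" for P :: "nat \<Rightarrow> 'a \<Rightarrow> bool" and \<omega>
    by (simp add: log_average_def indicator_def fun_eq_iff)
  have G_meas: "G n \<in> borel_measurable M" if "n \<ge> 1" for n
    using assms(2) that unfolding satisfies_ASCLT_def by blast
  have G_lim: "AE \<omega> in M. \<forall>z. log_average (\<lambda>k. of_bool (G k \<omega> \<le> z)) \<longlonglongrightarrow> std_normal_cdf z"
    using assms(2) unfolding satisfies_ASCLT_def average_eq by blast
  have moving: "AE \<omega> in M. \<forall>z.
      log_average (\<lambda>k. of_bool (G k \<omega> \<le> z * R k \<omega>)) \<longlonglongrightarrow> std_normal_cdf z"
    using G_lim assms(5)
  proof eventually_elim
    case (elim \<omega>)
    show ?case
    proof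
      fix z
      have t: "(\<lambda>k. z * R k \<omega>) \<longlonglongrightarrow> z"
        using tendsto_mult_left[OF elim(2), of z] by simp
      show "log_average (\<lambda>k. of_bool (G k \<omega> \<le> z * R k \<omega>)) \<longlonglongrightarrow> std_normal_cdf z"
        by (rule log_average_moving_threshold[OF elim(1)[rule_format] isCont_std_normal_cdf t])
    qed
  qed
  have "AE \<omega> in M. \<forall>k\<in>{1..}. 0 < R k \<omega>"
    using assms(4) by (subst AE_ball_countable) auto
  with moving have "AE \<omega> in M. \<forall>z.
      log_average (\<lambda>k. of_bool (G k \<omega> / R k \<omega> \<le> z)) \<longlonglongrightarrow> std_normal_cdf z"
  proof eventually_elim
    case (elim \<omega>)
    have "log_average (\<lambda>k. of_bool (G k \<omega> / R k \<omega> \<le> z))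
        = log_average (\<lambda>k. of_bool (G k \<omega> \<le> z * R k \<omega>))" for z
      unfolding log_average_def fun_eq_iff
      using elim(2) by (intro allI arg_cong2[where f = "(*)"] refl sum.cong) (auto simp: pos_divide_le_eq)
    with elim(1) show ?case by simp
  qed
  moreover have "(\<lambda>\<omega>. G n \<omega> / R n \<omega>) \<in> borel_measurable M" if "n \<ge> 1" for n
    using G_meas[OF that] assms(3)[OF that] by (rule borel_measurable_divide)
  ultimately show ?thesis
    using moving unfolding satisfies_ASCLT_def average_eq by blast
qed

end
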